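(* Let $n = p_1^{k_1}\cdots p_t^{k_t}$ where $t\ge2$, $p_1<\cdots<p_t$ are primes, and $k_1,\dots,k_t$ are positive integers. Let $$S(B_n)=\left\langle \left\{\binom n1,\dots,\binom n{n-1}\right\}\right\rangle.$$ Then: (a) $S(B_n) = \left\langle\left\{\binom n1\right\}\cup\left\{\binom{n}{p_i^j} : 1\le i\le t,\ 1\le j\le k_i\right\}\right\rangle$; (b) the embedding dimension of $S(B_n)$ is $e(S(B_n)) = 1+\sum_{i=1}^t k_i$.
   Context: $\mathbb{N}$ is the set of nonnegative integers. For nonempty $A\subseteq\mathbb{N}$, $\langle A\rangle$ denotes the submonoid of $(\mathbb{N},+)$ generated by $A$. A numerical semigroup is a submonoid of $\mathbb{N}$ with finite complement; $S(B_n)$ is a numerical semigroup here because $n$ is not a prime power. Every numerical semigroup $S$ has a unique minimal system of generators (a generating set no proper subset of which generates $S$), which is finite; its cardinality is the embedding dimension $e(S)$. *)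

theory Defs
  imports "HOL-Computational_Algebra.Primes" "HOL.Hull"
begin

definition add_submonoid :: "nat set \<Rightarrow> bool" where
  "add_submonoid S \<longleftrightarrow> 0 \<in> S \<and> (\<forall>a\<in>S. \<forall>b\<in>S. a + b \<in> S)"

definition generated_by :: "nat set \<Rightarrow> nat set" where
  "generated_by A = add_submonoid hull A"

definition minimal_generators :: "nat set \<Rightarrow> nat set \<Rightarrow> bool" where
  "minimal_generators S A \<longleftrightarrow> generated_by A = S \<and> (\<forall>B. B \<subset> A \<longrightarrow> generated_by B \<noteq> S)"

text \<open>The description operator and the cardinality below are meaningful for every submonoid of
  the naturals, in particular for every numerical semigroup: see \<open>minimal_generators_unique\<close>
  and \<open>minimal_generators_finite\<close>.\<close>

definition embedding_dimension :: "nat set \<Rightarrow> nat" where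
  "embedding_dimension S = card (THE A. minimal_generators S A)"

definition binomial_semigroup :: "nat \<Rightarrow> nat set" where
  "binomial_semigroup n = generated_by {n choose i | i. 1 \<le> i \<and> i \<le> n - 1}"

lemma add_submonoid_generated_by: "add_submonoid (generated_by A)"
  unfolding generated_by_def by (rule hull_in) (auto simp: add_submonoid_def)

text \<open>The minimal system of generators consists of the nonzero elements that are not a sum of
  two nonzero elements.\<close>

definition atoms_of :: "nat set \<Rightarrow> nat set" where
  "atoms_of S = {x \<in> S. x \<noteq> 0 \<and> (\<forall>a\<in>S. \<forall>b\<in>S. x = a + b \<longrightarrow> a = 0 \<or> b = 0)}"

lemma atoms_of_subset_generators:
  assumes "generated_by A = S"
  shows "atoms_of S \<subseteq> A"
proof
  fix x assume x: "x \<in> atoms_of S"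
  have S: "add_submonoid S" using assms add_submonoid_generated_by by blast
  show "x \<in> A"
  proof (rule ccontr)
    assume "x \<notin> A"
    moreover have "A \<subseteq> S"
      using assms hull_subset[of A add_submonoid] by (simp add: generated_by_def)
    ultimately have "A \<subseteq> S - {x}" by blast
    moreover have "add_submonoid (S - {x})"
      unfolding add_submonoid_def
    proof (intro conjI ballI)
      show "0 \<in> S - {x}" using S x by (simp add: add_submonoid_def atoms_of_def)
    next
      fix a b assume ab: "a \<in> S - {x}" "b \<in> S - {x}"
      then have "a + b \<in> S" using S by (simp add: add_submonoid_def)
      moreover have "a + b \<noteq> x"
      proof
        assume "a + b = x"
        then have "a = 0 \<or> b = 0" using x ab unfolding atoms_of_def by blast
        then show False using \<open>a + b = x\<close> ab by auto
      qed
      ultimately show "a + b \<in> S - {x}" by blast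
    qed
    ultimately have "generated_by A \<subseteq> S - {x}"
      unfolding generated_by_def by (rule hull_minimal)
    then show False using assms x by (auto simp: atoms_of_def)
  qed
qed

lemma generated_by_atoms_of:
  assumes "add_submonoid S"
  shows "generated_by (atoms_of S) = S"
proof
  show "generated_by (atoms_of S) \<subseteq> S"
    unfolding generated_by_def by (rule hull_minimal) (auto simp: atoms_of_def assms)
next
  let ?G = "generated_by (atoms_of S)"
  have G: "add_submonoid ?G" by (rule add_submonoid_generated_by)
  have "x \<in> S \<Longrightarrow> x \<in> ?G" for x
  proof (induction x rule: less_induct)
    case (less x)
    consider "x = 0" | "x \<in> atoms_of S"
      | a b where "a \<in> S" "b \<in> S" "x = a + b" "a \<noteq> 0" "b \<noteq> 0"
      using less.prems by (auto simp: atoms_of_def)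
    then show ?case
    proof cases
      case 1
      then show ?thesis using G by (simp add: add_submonoid_def)
    next
      case 2
      then show ?thesis by (simp add: generated_by_def hull_inc)
    next
      case 3
      then have "a \<in> ?G" "b \<in> ?G" using less.IH by auto
      then show ?thesis using G 3 by (simp add: add_submonoid_def)
    qed
  qed
  then show "S \<subseteq> ?G" by blast
qed

lemma minimal_generators_iff:
  assumes "add_submonoid S"
  shows "minimal_generators S A \<longleftrightarrow> A = atoms_of S"
proof
  assume "minimal_generators S A"
  then have "generated_by A = S" "\<not> atoms_of S \<subset> A"
    using generated_by_atoms_of[OF assms] by (auto simp: minimal_generators_def)
  then show "A = atoms_of S" using atoms_of_subset_generators[of A S] by blast
next
  assume "A = atoms_of S"
  moreover have "generated_by B \<noteq> S" if "B \<subset> atoms_of S" for B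
    using that atoms_of_subset_generators[of B S] by blast
  ultimately show "minimal_generators S A"
    using generated_by_atoms_of[OF assms] by (simp add: minimal_generators_def)
qed

lemma minimal_generators_unique:
  assumes "add_submonoid S"
  shows "\<exists>!A. minimal_generators S A"
  using minimal_generators_iff[OF assms] by simp

lemma minimal_generators_finite:
  assumes S: "add_submonoid S" and A: "minimal_generators S A"
  shows "finite A"
proof (cases "\<exists>m\<in>S. m \<noteq> 0")
  case False
  then have "atoms_of S = {}" by (auto simp: atoms_of_def)
  then show ?thesis using A minimal_generators_iff[OF S] by simp
next
  case True
  then obtain m where m: "m \<in> S" "m \<noteq> 0" by blast
  have mult: "q * m \<in> S" for q
    using S m by (induction q) (auto simp: add_submonoid_def)
  have less: False if x: "x \<in> atoms_of S" and y: "y \<in> atoms_of S"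
    and xy: "x < y" "x mod m = y mod m" for x y
  proof -
    have "m dvd y - x" using xy mod_eq_dvd_iff_nat[of x y m] by simp
    then obtain q where "y - x = m * q" by (rule dvdE)
    then have "q * m = y - x" by (simp add: mult.commute)
    then have "y = x + q * m" "q * m \<noteq> 0" using xy(1) by linarith+
    moreover have "x \<in> S" "x \<noteq> 0" using x by (simp_all add: atoms_of_def)
    moreover have "\<forall>a\<in>S. \<forall>b\<in>S. y = a + b \<longrightarrow> a = 0 \<or> b = 0"
      using y unfolding atoms_of_def by blast
    ultimately show False using mult[of q] by metis
  qed
  have "inj_on (\<lambda>x. x mod m) (atoms_of S)"
  proof (rule inj_onI)
    fix x y assume "x \<in> atoms_of S" "y \<in> atoms_of S" "x mod m = y mod m"
    then show "x = y" using less[of x y] less[of y x] by (cases x y rule: linorder_cases) auto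
  qed
  moreover have "(\<lambda>x. x mod m) ` atoms_of S \<subseteq> {..<m}" using m by auto
  ultimately have "finite (atoms_of S)" by (rule inj_on_finite) simp
  then show ?thesis using A minimal_generators_iff[OF S] by simp
qed

end

theory Submission
  imports Defs Complex_Main "HOL-Number_Theory.Cong"
begin

text \<open>
  For a prime \<open>p\<close> and \<open>p\<^sup>a\<close> dividing \<open>n\<close>, the exponent of \<open>p\<close> in \<open>n choose p\<^sup>a\<close> is \<open>k - a\<close>, where
  \<open>k\<close> is the exponent of \<open>p\<close> in \<open>n\<close>, while in general the exponent of \<open>p\<close> in \<open>n choose i\<close> is at
  least \<open>k\<close> minus that in \<open>i\<close>.

  Generation: by symmetry let \<open>2 i \<le> n\<close>, and let \<open>q\<^sub>p\<close> be the largest power of \<open>p\<close> dividing both \<open>i\<close>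
  and \<open>n\<close>. Working modulo each prime power in \<open>n\<close> separately gives coefficients \<open>c\<^sub>p < q\<^sub>p\<close> such that
  \<open>n choose i\<close> is congruent to the sum of the \<open>c\<^sub>p (n choose q\<^sub>p)\<close> modulo \<open>n = n choose 1\<close>. If \<open>i\<close> is
  not itself a prime power dividing \<open>n\<close>, then every \<open>q\<^sub>p\<close> is at most \<open>i/2\<close> and the sum of the
  \<open>q\<^sub>p - 1\<close> is at most \<open>i/2\<close>, so that this sum does not exceed \<open>n choose i\<close>, and the difference is a
  nonnegative multiple of \<open>n\<close>.

  Minimality: every generator smaller than \<open>n choose p\<^sup>j\<close> is divisible by \<open>p\<^sup>k\<^sup>-\<^sup>j\<^sup>+\<^sup>1\<close>, but
  \<open>n choose p\<^sup>j\<close> is not. So every generator is an atom.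
\<close>

section \<open>Generated submonoids and a criterion for atoms\<close>

lemma generated_by_subset_iff:
  assumes "add_submonoid S"
  shows "generated_by A \<subseteq> S \<longleftrightarrow> A \<subseteq> S"
  unfolding generated_by_def
  using assms by (metis hull_minimal hull_subset subset_trans)

lemma generated_by_incl: "x \<in> A \<Longrightarrow> x \<in> generated_by A"
  by (simp add: generated_by_def hull_inc)

lemma generated_by_add:
  "x \<in> generated_by A \<Longrightarrow> y \<in> generated_by A \<Longrightarrow> x + y \<in> generated_by A"
  using add_submonoid_generated_by by (simp add: add_submonoid_def)

lemma generated_by_mult: "x \<in> generated_by A \<Longrightarrow> c * x \<in> generated_by A"
  using add_submonoid_generated_by[of A]
  by (induction c) (auto simp: add_submonoid_def)

lemma generated_by_sum:
  assumes "\<And>i. i \<in> I \<Longrightarrow> f i \<in> generated_by A"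
  shows "sum f I \<in> generated_by A"
  using assms add_submonoid_generated_by[of A]
  by (induction I rule: infinite_finite_induct) (auto simp: add_submonoid_def)

text \<open>The numbers that are at least \<open>x\<close> or divisible by \<open>d\<close> form a
  submonoid containing \<open>A\<close>. If \<open>x\<close> had two nonzero summands, both would be
  smaller than \<open>x\<close>, hence divisible by \<open>d\<close>, and so would be
  \<open>x\<close>.\<close>

lemma atom_if_not_dvd:
  assumes "x \<in> A" and smaller: "\<And>y. y \<in> A \<Longrightarrow> y < x \<Longrightarrow> d dvd y" and "\<not> d dvd x"
  shows "x \<in> atoms_of (generated_by A)"
proof -
  let ?T = "{y. y < x \<longrightarrow> d dvd y}"
  have "add_submonoid ?T" by (auto simp: add_submonoid_def)
  moreover have "A \<subseteq> ?T" using smaller by blast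
  ultimately have T: "generated_by A \<subseteq> ?T" using generated_by_subset_iff by blast
  have "a = 0 \<or> b = 0" if "a \<in> generated_by A" "b \<in> generated_by A" "x = a + b" for a b
  proof (rule ccontr)
    assume "\<not> (a = 0 \<or> b = 0)"
    then have "d dvd a" "d dvd b" using T that by auto
    then show False using \<open>\<not> d dvd x\<close> that by simp
  qed
  moreover have "x \<noteq> 0" using \<open>\<not> d dvd x\<close> by (metis dvd_0_right)
  ultimately show ?thesis
    using \<open>x \<in> A\<close> by (auto simp: atoms_of_def generated_by_incl)
qed

section \<open>The exponent of a prime in a binomial coefficient\<close>

text \<open>In \<open>s * (n choose s) = n * ((n - 1) choose (s - 1))\<close> the right side is
  divisible by \<open>p ^ k\<close>, and \<open>s\<close> accounts for no more than its own power of
  \<open>p\<close>. Truncated subtraction makes the claim trivial once that exponent exceeds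
  \<open>k\<close>.\<close>

lemma prime_power_dvd_choose:
  fixes p :: nat
  assumes "prime p" "p ^ k dvd n" "s > 0"
  shows "p ^ (k - multiplicity p s) dvd (n choose s)"
proof -
  obtain u where u: "s = p ^ multiplicity p s * u" "\<not> p dvd u"
    using multiplicity_decompose'[of s p] assms by (metis not_gr_zero not_prime_unit)
  have "p ^ k dvd s * (n choose s)"
    using assms times_binomial_minus1_eq[of s n] by simp
  then have "p ^ k dvd u * (p ^ multiplicity p s * (n choose s))"
    using u(1) by (metis mult.assoc mult.commute)
  moreover have "coprime (p ^ k) u"
    using assms u(2) by (simp add: prime_imp_coprime)
  ultimately have *: "p ^ k dvd p ^ multiplicity p s * (n choose s)"
    using coprime_dvd_mult_right_iff by blast
  show ?thesis
  proof (cases "multiplicity p s \<le> k")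
    case True
    then have "p ^ multiplicity p s * p ^ (k - multiplicity p s) dvd p ^ multiplicity p s * (n choose s)"
      using * by (simp flip: power_add)
    then show ?thesis using assms(1) by (simp add: prime_gt_0_nat)
  qed simp
qed

text \<open>By Pascal's rule neighbouring entries of row \<open>n - 1\<close> add up to
  \<open>n choose Suc s\<close>, which \<open>p\<close> divides because
  \<open>Suc s < p ^ a\<close>. So non-divisibility passes along the row from its first entry
  1.\<close>

lemma prime_not_dvd_choose_pred:
  fixes p :: nat
  assumes "prime p" "p ^ a dvd n" "n > 0" "s < p ^ a"
  shows "\<not> p dvd ((n - 1) choose s)"
  using \<open>s < p ^ a\<close>
proof (induction s)
  case 0
  then show ?case using assms(1) by auto
next
  case (Suc s)
  have "p ^ multiplicity p (Suc s) \<le> Suc s"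
    by (rule dvd_imp_le[OF multiplicity_dvd]) simp
  then have "p ^ multiplicity p (Suc s) < p ^ a" using Suc.prems by linarith
  then have "multiplicity p (Suc s) < a"
    using prime_gt_1_nat[OF assms(1)] by simp
  then have "p dvd p ^ (a - multiplicity p (Suc s))" by simp
  then have "p dvd (n choose Suc s)"
    using prime_power_dvd_choose[OF assms(1,2), of "Suc s"] dvd_trans by blast
  moreover have "n choose Suc s = ((n - 1) choose s) + ((n - 1) choose Suc s)"
    using choose_reduce_nat[of n "Suc s"] assms(3) by simp
  moreover have "\<not> p dvd ((n - 1) choose s)" using Suc by simp
  ultimately show ?case by (metis dvd_add_left_iff)
qed

text \<open>In \<open>p ^ a * (n choose p ^ a) = n * ((n - 1) choose (p ^ a - 1))\<close> the last
  factor is prime to \<open>p\<close>, so both sides have exactly the exponent of \<open>p\<close>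
  in \<open>n\<close>.\<close>

lemma prime_power_not_dvd_choose:
  fixes p :: nat
  assumes "prime p" "p ^ a dvd n" "n > 0"
  shows "\<not> p ^ Suc (multiplicity p n - a) dvd (n choose p ^ a)"
proof
  let ?k = "multiplicity p n"
  have ak: "a \<le> ?k"
    using assms by (metis multiplicity_geI not_prime_unit not_gr_zero)
  have q: "p ^ a > 0" using assms(1) by (simp add: prime_gt_0_nat)
  assume "p ^ Suc (?k - a) dvd (n choose p ^ a)"
  then have "p ^ a * p ^ Suc (?k - a) dvd p ^ a * (n choose p ^ a)" by (rule mult_dvd_mono[OF dvd_refl])
  then have "p ^ Suc ?k dvd n * ((n - 1) choose (p ^ a - 1))"
    using ak times_binomial_minus1_eq[OF q, of n] by (simp flip: power_add add: power_Suc[symmetric] del: power_Suc)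
  moreover have "coprime (p ^ Suc ?k) ((n - 1) choose (p ^ a - 1))"
    using prime_not_dvd_choose_pred[OF assms, of "p ^ a - 1"] q assms(1)
    by (metis coprime_power_left_iff diff_less prime_imp_coprime zero_less_one)
  ultimately have "p ^ Suc ?k dvd n" using coprime_dvd_mult_left_iff by blast
  then have "Suc ?k \<le> ?k" using assms by (metis multiplicity_geI not_prime_unit not_gr_zero)
  then show False by simp
qed

section \<open>Growth of binomial coefficients\<close>

text \<open>Raising the upper index from \<open>2 * q + s\<close> by one multiplies the coefficient
  by (2q + s + 1) / (q + s + 1), which is at least 3/2 as long as s + 1 \<le> q.\<close>

lemma three_power_binomial_le:
  "s \<le> q \<Longrightarrow> 3 ^ s * ((2 * q) choose q) \<le> 2 ^ s * ((2 * q + s) choose q)"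
proof (induction s)
  case (Suc s)
  let ?C = "(2 * q + s) choose q"
  have "(Suc (2 * q + s) - q) * (Suc (2 * q + s) choose q) = Suc (2 * q + s) * ?C"
    using binomial_absorb_comp[of "Suc (2 * q + s)" q] by simp
  then have eq: "(q + s + 1) * ((2 * q + Suc s) choose q) = (2 * q + s + 1) * ?C"
    by (simp add: algebra_simps Suc_diff_le)
  have "3 * ?C * (q + s + 1) = (3 * (q + s + 1)) * ?C" by (simp only: mult_ac)
  also have "\<dots> \<le> (2 * (2 * q + s + 1)) * ?C"
    using Suc.prems by (intro mult_right_mono) auto
  also have "\<dots> = 2 * ((q + s + 1) * ((2 * q + Suc s) choose q))" unfolding eq by simp
  finally have "3 * ?C * (q + s + 1) \<le> 2 * ((2 * q + Suc s) choose q) * (q + s + 1)"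
    by (simp only: mult_ac)
  then have step: "3 * ?C \<le> 2 * ((2 * q + Suc s) choose q)"
    by (metis Suc_eq_plus1 mult_le_cancel2 zero_less_Suc)
  have "3 ^ Suc s * ((2 * q) choose q) \<le> 3 * (2 ^ s * ?C)"
    using Suc by simp
  also have "\<dots> = 2 ^ s * (3 * ?C)" by simp
  also have "\<dots> \<le> 2 ^ s * (2 * ((2 * q + Suc s) choose q))" using step by simp
  finally show ?case by simp
qed simp

lemma mult_two_power_le_three_power: "q * 2 ^ q \<le> (3::nat) ^ q"
proof (induction q)
  case (Suc q)
  consider "q = 0" | "q = 1" | "q \<ge> 2" by linarith
  then show ?case
  proof cases
    case 3
    have "Suc q * 2 ^ Suc q = (2 * q + 2) * 2 ^ q" by simp
    also have "\<dots> \<le> (3 * q) * 2 ^ q" using 3 by (intro mult_right_mono) auto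
    also have "\<dots> \<le> 3 ^ Suc q" using Suc by simp
    finally show ?thesis .
  qed auto
qed simp

text \<open>The quotient of \<open>n choose (2 * q)\<close> by \<open>n choose q\<close> is that of
  \<open>(n - q) choose q\<close> by \<open>(2 * q) choose q\<close>. Since n - q \<ge> 3q, it is at
  least (3/2)^q, hence at least q.\<close>

lemma mult_choose_le_choose_double:
  assumes "4 * q \<le> n"
  shows "q * (n choose q) \<le> n choose (2 * q)"
proof -
  have "2 ^ q * (q * ((2 * q) choose q)) \<le> 3 ^ q * ((2 * q) choose q)"
    using mult_two_power_le_three_power[of q] by (simp add: mult.commute mult.left_commute)
  also have "\<dots> \<le> 2 ^ q * ((3 * q) choose q)"
    using three_power_binomial_le[of q q] by (simp add: algebra_simps)
  finally have "q * ((2 * q) choose q) \<le> (3 * q) choose q" by simp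
  also have "\<dots> \<le> (n - q) choose q"
    using assms by (intro binomial_right_mono) simp
  finally have "(q * ((2 * q) choose q)) * (n choose q) \<le> ((n - q) choose q) * (n choose q)"
    by (rule mult_right_mono) simp
  also have "\<dots> = (n choose (2 * q)) * ((2 * q) choose q)"
    using choose_mult[of q "2 * q" n] assms by simp
  finally have "(q * (n choose q)) * ((2 * q) choose q) \<le> (n choose (2 * q)) * ((2 * q) choose q)"
    by (simp only: mult_ac)
  then show ?thesis by simp
qed

section \<open>Bounding sums by products\<close>

text \<open>The induction step is (a + 1)(b + 1) - 1 = ab + a + b \<ge> a + b.\<close>

lemma sum_pred_le_prod_pred:
  fixes f :: "'a \<Rightarrow> nat"
  assumes "\<And>i. i \<in> I \<Longrightarrow> f i > 0"
  shows "(\<Sum>i\<in>I. f i - 1) \<le> (\<Prod>i\<in>I. f i) - 1"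
  using assms
proof (induction I rule: infinite_finite_induct)
  case (insert x I)
  have "f x > 0" "prod f I > 0" using insert by (auto intro: prod_pos)
  then obtain a b where "f x = Suc a" "prod f I = Suc b" by (meson gr0_implies_Suc)
  then show ?case using insert by simp
qed auto

text \<open>If \<open>i = f x * m\<close> with both factors at least 2, then the bound is
  \<open>(f x - 2) * (m - 2) \<ge> 0\<close>; the remaining factors are absorbed into \<open>m\<close>.\<close>

lemma sum_pred_le_half:
  fixes f :: "'a \<Rightarrow> nat"
  assumes fin: "finite I" and dvd: "prod f I dvd i" and "i > 0"
    and pos: "\<And>x. x \<in> I \<Longrightarrow> f x > 0" and half: "\<And>x. x \<in> I \<Longrightarrow> 2 * f x \<le> i"
  shows "(\<Sum>x\<in>I. f x - 1) \<le> i div 2"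
proof (cases "\<exists>x\<in>I. f x \<ge> 2")
  case False
  then have "\<And>x. x \<in> I \<Longrightarrow> f x - 1 = 0" by fastforce
  then show ?thesis by simp
next
  case True
  then obtain x where x: "x \<in> I" "f x \<ge> 2" by blast
  let ?P = "prod f (I - {x})"
  have P: "prod f I = f x * ?P" using fin x by (simp add: prod.remove)
  then obtain r where r: "i = f x * (?P * r)" using dvd by (auto simp: dvd_def mult.assoc)
  define m where "m = ?P * r"
  have "?P dvd m" "m > 0" using r \<open>i > 0\<close> by (auto simp: m_def)
  then have Pm: "?P \<le> m" by (simp add: dvd_imp_le)
  have im: "i = f x * m" using r by (simp add: m_def)
  have "f x * 2 \<le> f x * m" using half[OF x(1)] im by simp
  then have m2: "m \<ge> 2" using x(2) by simp
  obtain u v where uv: "f x = u + 2" "m = v + 2"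
    using x(2) m2 by (metis add.commute le_Suc_ex)
  have "(\<Sum>x\<in>I. f x - 1) = (f x - 1) + (\<Sum>y\<in>I - {x}. f y - 1)"
    using fin x by (simp add: sum.remove)
  also have "\<dots> \<le> (f x - 1) + (m - 1)"
    using sum_pred_le_prod_pred[of "I - {x}" f] pos Pm by fastforce
  also have "\<dots> \<le> i div 2"
    unfolding im uv by (simp add: algebra_simps)
  finally show ?thesis .
qed


text \<open>The exponent 0 is allowed, so 1 is a member and the generator \<open>n choose 1\<close> needs no separate
  treatment.\<close>

definition prime_power_divisors :: "nat \<Rightarrow> nat set" where
  "prime_power_divisors n = {p ^ j | p j. prime p \<and> p ^ j dvd n}"

section \<open>Representing \<open>n choose i\<close> by the generators\<close>

lemma ex_cong_choose:
  fixes p n i :: nat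
  assumes p: "prime p" and "n > 0" "i > 0"
  defines "q \<equiv> p ^ min (multiplicity p i) (multiplicity p n)"
  shows "\<exists>c<q. [c * (n choose q) = n choose i] (mod p ^ multiplicity p n)"
proof -
  let ?k = "multiplicity p n" and ?a = "min (multiplicity p i) (multiplicity p n)"
  have qn: "q dvd n" unfolding q_def by (rule multiplicity_dvd') simp
  have q0: "q > 0" using p by (simp add: q_def prime_gt_0_nat)
  obtain b where b: "b \<le> ?k" "gcd (n choose q) (p ^ ?k) = p ^ b"
    using divides_primepow_nat[OF p, of "gcd (n choose q) (p ^ ?k)" ?k] by auto
  \<comment> \<open>This gives \<open>b \<le> ?k - ?a\<close>, and \<open>?k - ?a\<close> equals the
    truncated \<open>?k - multiplicity p i\<close>. So the gcd divides \<open>n choose i\<close> and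
    the congruence is solvable.\<close>
  have "\<not> Suc (?k - ?a) \<le> b"
    using prime_power_not_dvd_choose[OF p, of ?a n] qn \<open>n > 0\<close> b(2)
    by (metis dvd_trans gcd_dvd1 le_imp_power_dvd q_def)
  then have "p ^ b dvd p ^ (?k - multiplicity p i)"
    by (intro le_imp_power_dvd) linarith
  also have "\<dots> dvd (n choose i)"
    using prime_power_dvd_choose[OF p multiplicity_dvd \<open>i > 0\<close>] .
  finally obtain x where x: "[(n choose q) * x = n choose i] (mod p ^ ?k)"
    using cong_solve_dvd_nat[of "n choose q" "p ^ ?k" "n choose i"] b(2) by auto
  \<comment> \<open>Hence adding multiples of \<open>q\<close> to the coefficient changes nothing
    modulo \<open>p ^ ?k\<close>, and \<open>x\<close> may be reduced to
    \<open>x mod q\<close>.\<close>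
  have "n dvd q * (n choose q)"
    using times_binomial_minus1_eq[OF q0, of n] by simp
  then have "p ^ ?k dvd q * (n choose q) * (x div q)"
    using multiplicity_dvd[of p n] dvd_trans dvd_mult2 by blast
  then have "[x mod q * (n choose q) + q * (n choose q) * (x div q)
      = x mod q * (n choose q) + 0] (mod p ^ ?k)"
    by (intro cong_add cong_refl) (simp add: cong_0_iff)
  moreover have "x mod q * (n choose q) + q * (n choose q) * (x div q) = (x mod q + q * (x div q)) * (n choose q)"
    by (simp only: algebra_simps)
  then have "x mod q * (n choose q) + q * (n choose q) * (x div q) = (n choose q) * x"
    by simp
  ultimately have "[x mod q * (n choose q) = n choose i] (mod p ^ ?k)"
    using x by (metis add_0_right cong_sym cong_trans)
  then show ?thesis using q0 by (intro exI[of _ "x mod q"]) simp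
qed

lemma coprime_distinct_prime_powers:
  fixes p q :: nat
  assumes "prime p" "prime q" "p \<noteq> q"
  shows "coprime (p ^ a) (q ^ b)"
  using primes_coprime[OF assms] by simp

lemma prod_prime_powers_dvd:
  fixes i :: nat
  assumes "finite P" "\<And>p. p \<in> P \<Longrightarrow> prime p" "\<And>p. p \<in> P \<Longrightarrow> p ^ f p dvd i"
  shows "(\<Prod>p\<in>P. p ^ f p) dvd i"
proof -
  have "[i = 0] (mod (\<Prod>p\<in>P. p ^ f p))"
    using assms coprime_distinct_prime_powers
    by (intro cong_cong_prod_coprime_nat ballI impI) (auto simp: cong_0_iff)
  then show ?thesis by (simp add: cong_0_iff)
qed

lemma choose_in_generated:
  assumes "0 < i" "2 * i \<le> n"
  shows "n choose i \<in> generated_by ((choose) n ` prime_power_divisors n)"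
proof (cases "i \<in> prime_power_divisors n")
  case True
  then show ?thesis by (intro generated_by_incl imageI)
next
  case False
  let ?G = "generated_by ((choose) n ` prime_power_divisors n)"
  let ?P = "prime_factors n"
  define q where "q p = p ^ min (multiplicity p i) (multiplicity p n)" for p
  have n0: "n > 0" using assms by simp
  have P: "finite ?P" "\<And>p. p \<in> ?P \<Longrightarrow> prime p" by auto
  have qD: "q p \<in> prime_power_divisors n" if "p \<in> ?P" for p
    using P(2)[OF that] multiplicity_dvd'[of "min (multiplicity p i) (multiplicity p n)" p n]
    by (auto simp: prime_power_divisors_def q_def)
  have qi: "q p dvd i" for p unfolding q_def by (rule multiplicity_dvd') simp
  have qhalf: "2 * q p \<le> i" if p: "p \<in> ?P" for p
  proof -
    obtain r where r: "i = q p * r" using qi by blast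
    \<comment> \<open>\<open>r = 1\<close> would make \<open>i\<close> equal to \<open>q p\<close>,
      a prime power dividing \<open>n\<close>.\<close>
    moreover have "r \<noteq> 0" "r \<noteq> 1" using r assms(1) qD[OF p] False by auto
    then have "2 \<le> r" by simp
    ultimately show ?thesis by simp
  qed
  have "\<forall>p\<in>?P. \<exists>c<q p. [c * (n choose q p) = n choose i] (mod p ^ multiplicity p n)"
    using ex_cong_choose[OF P(2) n0 assms(1)] unfolding q_def by blast
  then obtain c where c: "\<And>p. p \<in> ?P \<Longrightarrow> c p < q p"
    "\<And>p. p \<in> ?P \<Longrightarrow> [c p * (n choose q p) = n choose i] (mod p ^ multiplicity p n)"
    by metis
  let ?s = "\<Sum>p\<in>?P. c p * (n choose q p)"
  have "[n choose i = ?s] (mod (\<Prod>p\<in>?P. p ^ multiplicity p n))"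
  proof (intro cong_cong_prod_coprime_nat ballI impI)
    fix p assume p: "p \<in> ?P"
    \<comment> \<open>Only the summand of \<open>p\<close> survives: for the other primes,
      \<open>q r\<close> is prime to \<open>p\<close>, so \<open>n choose q r\<close> keeps the full
      power of \<open>p\<close> in \<open>n\<close>.\<close>
    have "p ^ multiplicity p n dvd (\<Sum>r\<in>?P - {p}. c r * (n choose q r))"
    proof (intro dvd_sum dvd_mult)
      fix r assume r: "r \<in> ?P - {p}"
      then have "multiplicity p (q r) = 0"
        using P(2) p unfolding q_def by (intro multiplicity_distinct_prime_power) auto
      moreover have "q r > 0" using r P(2) by (simp add: q_def prime_gt_0_nat)
      ultimately show "p ^ multiplicity p n dvd (n choose q r)"
        using prime_power_dvd_choose[OF P(2)[OF p] multiplicity_dvd, of "q r" n] by simp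
    qed
    then have "[c p * (n choose q p) + (\<Sum>r\<in>?P - {p}. c r * (n choose q r))
        = (n choose i) + 0] (mod p ^ multiplicity p n)"
      using c(2)[OF p] by (intro cong_add) (simp_all add: cong_0_iff)
    then show "[n choose i = ?s] (mod p ^ multiplicity p n)"
      using p by (simp add: sum.remove[of ?P p] cong_sym)
  qed (use P(2) coprime_distinct_prime_powers in auto)
  then have cong: "[n choose i = ?s] (mod n)"
    using prime_factorization_nat[OF n0] by simp
  \<comment> \<open>\<open>i div 2\<close> is at least every \<open>q p\<close> and at most a
    quarter of \<open>n\<close>, so it can serve as a common lower index and be doubled
    afterwards.\<close>
  have "?s \<le> (\<Sum>p\<in>?P. (q p - 1) * (n choose (i div 2)))"
  proof (intro sum_mono mult_mono)
    fix p assume p: "p \<in> ?P"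
    show "c p \<le> q p - 1" using c(1)[OF p] by simp
    show "n choose q p \<le> n choose (i div 2)"
      using qhalf[OF p] assms(2) by (intro binomial_mono) auto
  qed simp_all
  also have "\<dots> = (\<Sum>p\<in>?P. q p - 1) * (n choose (i div 2))"
    by (simp add: sum_distrib_right)
  also have "\<dots> \<le> (i div 2) * (n choose (i div 2))"
  proof (intro mult_right_mono sum_pred_le_half)
    show "prod q ?P dvd i"
      unfolding q_def by (intro prod_prime_powers_dvd multiplicity_dvd') auto
  qed (use P(2) qhalf assms in \<open>auto simp: q_def prime_gt_0_nat\<close>)
  also have "\<dots> \<le> n choose (2 * (i div 2))"
    using assms(2) by (intro mult_choose_le_choose_double) linarith
  also have "\<dots> \<le> n choose i"
    using assms(2) by (intro binomial_mono) auto
  finally have le: "?s \<le> n choose i" .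
  then obtain d where "n choose i = d * n + ?s"
    using cong_le_nat[OF le, of n] cong by (auto simp: cong_sym_eq)
  \<comment> \<open>The prime 2 is an arbitrary choice: exponent 0 yields 1 whether or not 2 divides
    \<open>n\<close>.\<close>
  have "2 ^ 0 \<in> prime_power_divisors n"
    unfolding prime_power_divisors_def by (intro CollectI exI[of _ 2] exI[of _ 0]) simp
  then have "n choose 1 \<in> ?G" by (intro generated_by_incl imageI) simp
  then have "n \<in> ?G" by simp
  moreover have "?s \<in> ?G"
    by (intro generated_by_sum generated_by_mult generated_by_incl imageI qD)
  ultimately show ?thesis
    using \<open>n choose i = d * n + ?s\<close> by (metis generated_by_add generated_by_mult)
qed

section \<open>Equality of the semigroups, atoms and their number\<close>

text \<open>\<open>n \<notin> prime_power_divisors n\<close> encodes that \<open>n\<close> is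
  neither 1 nor a prime power. All members are then proper divisors, so they lie in the range where
  \<open>n choose s\<close> increases strictly with \<open>s\<close>.\<close>

lemma prime_power_divisor_le_half:
  assumes "n > 0" "n \<notin> prime_power_divisors n" "s \<in> prime_power_divisors n"
  shows "0 < s" "2 * s \<le> n"
proof -
  have "s dvd n" "s \<noteq> n" using assms by (auto simp: prime_power_divisors_def)
  then obtain r where r: "n = s * r" "r \<noteq> 1" by (auto simp: dvd_def)
  with assms(1) have "2 \<le> r" "s > 0" by (cases r; auto)+
  then show "0 < s" "2 * s \<le> n" using r by simp_all
qed

lemma binomial_semigroup_eq_generated:
  assumes "n > 0" "n \<notin> prime_power_divisors n"
  shows "binomial_semigroup n = generated_by ((choose) n ` prime_power_divisors n)"
proof (rule subset_antisym)
  let ?G = "generated_by ((choose) n ` prime_power_divisors n)"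
  have "n choose i \<in> ?G" if "1 \<le> i" "i \<le> n - 1" for i
  proof (cases "2 * i \<le> n")
    case True
    then show ?thesis using choose_in_generated that by simp
  next
    case False
    then have "n choose (n - i) \<in> ?G" using choose_in_generated[of "n - i" n] that by simp
    then show ?thesis using binomial_symmetric[of i n] that by simp
  qed
  then show "binomial_semigroup n \<subseteq> ?G"
    unfolding binomial_semigroup_def
    by (subst generated_by_subset_iff) (auto simp: add_submonoid_generated_by)
  have "n choose s \<in> binomial_semigroup n" if "s \<in> prime_power_divisors n" for s
    using prime_power_divisor_le_half[OF assms that] unfolding binomial_semigroup_def
    by (intro generated_by_incl CollectI exI[of _ s]) auto
  then show "?G \<subseteq> binomial_semigroup n"
    by (subst generated_by_subset_iff) (auto simp: binomial_semigroup_def add_submonoid_generated_by)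
qed

lemma atoms_of_generated_choose:
  assumes "n > 0" "n \<notin> prime_power_divisors n"
  shows "atoms_of (generated_by ((choose) n ` prime_power_divisors n))
    = (choose) n ` prime_power_divisors n"
proof
  let ?A = "(choose) n ` prime_power_divisors n"
  show "atoms_of (generated_by ?A) \<subseteq> ?A" by (rule atoms_of_subset_generators) simp
  note half = prime_power_divisor_le_half[OF assms]
  show "?A \<subseteq> atoms_of (generated_by ?A)"
  proof safe
    fix s assume s: "s \<in> prime_power_divisors n"
    then obtain p j where p: "prime p" "s = p ^ j" "p ^ j dvd n"
      by (auto simp: prime_power_divisors_def)
    have mono: "r < s" if "n choose r < n choose s" "r \<in> prime_power_divisors n" for r
      using that binomial_mono[of s r n] half(2)[of r] by (meson linorder_not_le)
    show "n choose s \<in> atoms_of (generated_by ?A)"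
    proof (cases "j = 0")
      case True
      show ?thesis
      proof (rule atom_if_not_dvd[where d = 0]) \<comment> \<open>no generator is smaller\<close>
        show "0 dvd y" if "y \<in> ?A" "y < n choose s" for y
          using that mono half(1) p(2) True by fastforce
        show "\<not> 0 dvd (n choose s)" using p(2) True assms(1) by simp
      qed (use s in blast)
    next
      case False
      let ?k = "multiplicity p n"
      have jk: "j \<le> ?k"
        using p assms(1) by (metis multiplicity_geI not_prime_unit not_gr_zero)
      show ?thesis
      proof (rule atom_if_not_dvd[where d = "p ^ Suc (?k - j)"])
        show "\<not> p ^ Suc (?k - j) dvd (n choose s)"
          using prime_power_not_dvd_choose[OF p(1,3) assms(1)] p(2) by simp
        fix y assume "y \<in> ?A" and less: "y < n choose s"
        then obtain r where r: "y = n choose r" "r \<in> prime_power_divisors n" by blast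
        then have "r < s" using less mono by simp
        obtain p' l where p': "prime p'" "r = p' ^ l"
          using r(2) by (auto simp: prime_power_divisors_def)
        \<comment> \<open>A smaller power of the same prime has a smaller exponent; a power of
          another prime has exponent 0 at \<open>p\<close>, which is below \<open>j\<close>.\<close>
        have "multiplicity p r < j"
        proof (cases "p' = p")
          case True
          then show ?thesis
            using \<open>r < s\<close> p p' prime_gt_1_nat[OF p(1)] by simp
        next
          case False
          then show ?thesis
            using \<open>j \<noteq> 0\<close> p(1) p' by (simp add: multiplicity_distinct_prime_power)
        qed
        then have "p ^ Suc (?k - j) dvd p ^ (?k - multiplicity p r)"
          using jk by (intro le_imp_power_dvd) linarith
        also have "\<dots> dvd (n choose r)"
          by (rule prime_power_dvd_choose[OF p(1) multiplicity_dvd half(1)[OF r(2)]])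
        finally show "p ^ Suc (?k - j) dvd y" using r(1) by simp
      qed (use s in blast)
    qed
  qed
qed

lemma embedding_dimension_generated_choose:
  assumes "n > 0" "n \<notin> prime_power_divisors n"
  shows "embedding_dimension (generated_by ((choose) n ` prime_power_divisors n))
    = card (prime_power_divisors n)"
proof -
  have "inj_on ((choose) n) (prime_power_divisors n)"
  proof (rule inj_onI)
    fix x y assume "x \<in> prime_power_divisors n" "y \<in> prime_power_divisors n"
      and "n choose x = n choose y"
    then show "x = y"
      using prime_power_divisor_le_half(2)[OF assms] binomial_strict_mono[of x y n]
        binomial_strict_mono[of y x n]
      by (cases x y rule: linorder_cases) fastforce+
  qed
  \<comment> \<open>An equation between predicates, so that it can rewrite under the description
    operator.\<close>
  moreover have "minimal_generators (generated_by A) = (\<lambda>B. B = atoms_of (generated_by A))" for A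
    using minimal_generators_iff[OF add_submonoid_generated_by] by blast
  ultimately show ?thesis
    unfolding embedding_dimension_def
    by (simp add: atoms_of_generated_choose[OF assms] card_image)
qed

section \<open>Counting prime power divisors from the factorization of \<open>n\<close>\<close>

theorem theorem3p2:
  fixes n t :: nat and p k :: "nat \<Rightarrow> nat"
  assumes "t \<ge> 2"
    and "\<And>i. i \<in> {1..t} \<Longrightarrow> prime (p i)"
    and "strict_mono_on {1..t} p"
    and "\<And>i. i \<in> {1..t} \<Longrightarrow> k i > 0"
    and "n = (\<Prod>i=1..t. p i ^ k i)"
  shows "binomial_semigroup n =
           generated_by ({n choose 1} \<union>
             {n choose (p i ^ j) | i j. 1 \<le> i \<and> i \<le> t \<and> 1 \<le> j \<and> j \<le> k i})
         \<and> embedding_dimension (binomial_semigroup n) = 1 + (\<Sum>i=1..t. k i)"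
proof -
  let ?I = "{1..t}"
  let ?D = "prime_power_divisors n"
  have inj: "inj_on p ?I" using assms(3) by (rule strict_mono_on_imp_inj_on)
  have n0: "n > 0" using assms(2,5) by (auto intro!: prod_pos simp: prime_gt_0_nat)
  \<comment> \<open>The exponents are re-indexed by the primes themselves, the form in which
    multiplicities of a product of prime powers can be read off.\<close>
  define f where "f = k \<circ> inv_into ?I p"
  have n_eq: "n = (\<Prod>q\<in>p ` ?I. q ^ f q)"
    unfolding assms(5) f_def using inj by (simp add: prod.reindex)
  have mult: "multiplicity q n = (if q \<in> p ` ?I then f q else 0)" if "prime q" for q
    unfolding n_eq using assms(2) that by (intro multiplicity_prod_prime_powers) auto
  have mult_p: "multiplicity (p i) n = k i" if "i \<in> ?I" for i
    using mult[OF assms(2)[OF that]] that inj by (simp add: f_def)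
  have dvd_iff: "q ^ j dvd n \<longleftrightarrow> j \<le> multiplicity q n" if "prime q" for q j
    using n0 that by (metis not_gr_zero not_prime_unit power_dvd_iff_le_multiplicity)
  let ?J = "SIGMA i:?I. {1..k i}"
  have D: "?D = insert 1 ((\<lambda>(i, j). p i ^ j) ` ?J)"
  proof (intro subset_antisym subsetI)
    fix x assume "x \<in> ?D"
    then obtain q j where q: "prime q" "x = q ^ j" "j \<le> multiplicity q n"
      using dvd_iff by (auto simp: prime_power_divisors_def)
    show "x \<in> insert 1 ((\<lambda>(i, j). p i ^ j) ` ?J)"
    proof (cases "j = 0")
      case False
      then obtain i where i: "i \<in> ?I" "q = p i" using q mult[OF q(1)] by (auto split: if_splits)
      then have "(i, j) \<in> ?J" using q mult_p False by simp
      then show ?thesis using i q by (intro insertI2 image_eqI[of _ _ "(i, j)"]) simp_all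
    qed (use q in simp)
  next
    fix x assume "x \<in> insert 1 ((\<lambda>(i, j). p i ^ j) ` ?J)"
    then obtain i j where ij: "i \<in> ?I" "x = p i ^ j" "j \<le> k i"
    proof
      assume "x = 1"
      then show ?thesis using that[of 1 0] assms(1) by simp
    qed auto
    then have "p i ^ j dvd n" using dvd_iff[OF assms(2)] mult_p by simp
    then show "x \<in> ?D"
      using assms(2)[OF ij(1)] ij(2) unfolding prime_power_divisors_def by blast
  qed
  have notin: "n \<notin> ?D"
  proof
    assume "n \<in> ?D"
    then obtain q j where q: "prime q" "n = q ^ j" by (auto simp: prime_power_divisors_def)
    \<comment> \<open>Each \<open>p i\<close> has positive exponent in \<open>n = q ^ j\<close>,
      which forces it to be \<open>q\<close>; two distinct primes then contradict this.\<close>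
    have "p i = q" if "i \<in> ?I" for i
      using multiplicity_distinct_prime_power[OF assms(2)[OF that] q(1), of j] mult_p[OF that]
        assms(4)[OF that] q(2) by force
    then have "p 1 = p 2" using assms(1) by simp
    then show False using inj assms(1) by (auto dest: inj_onD)
  qed
  have injJ: "inj_on (\<lambda>(i, j). p i ^ j) ?J"
  proof (rule inj_onI, clarify)
    fix i j i' j' assume *: "i \<in> ?I" "j \<in> {1..k i}" "i' \<in> ?I" "j' \<in> {1..k i'}" "p i ^ j = p i' ^ j'"
    have "p i dvd p i' ^ j'" using * dvd_power[of j "p i"] by simp
    then have "p i dvd p i'" using prime_dvd_power[OF assms(2)[OF *(1)]] by blast
    then have eq: "p i = p i'" using assms(2) * by (intro primes_dvd_imp_eq) auto
    then have "i = i'" using inj * by (auto dest: inj_onD)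
    moreover have "j = j'" using *(5) eq prime_gt_1_nat[OF assms(2)[OF *(3)]] by simp
    ultimately show "i = i' \<and> j = j'" ..
  qed
  \<comment> \<open>The divisor 1 is thus counted separately; it gives \<open>n choose 1\<close> and
    the summand 1 in the embedding dimension.\<close>
  have "p (fst z) ^ snd z \<noteq> 1" if "z \<in> ?J" for z
    using prime_power_eq_one_iff[OF assms(2), of "fst z" "snd z"] that by auto
  then have "1 \<notin> (\<lambda>(i, j). p i ^ j) ` ?J"
    unfolding case_prod_beta by (metis (no_types, lifting) imageE)
  then have card: "card ?D = 1 + (\<Sum>i=1..t. k i)"
    unfolding D using injJ by (simp add: card_image)
  have "{n choose 1} \<union> {n choose (p i ^ j) | i j. 1 \<le> i \<and> i \<le> t \<and> 1 \<le> j \<and> j \<le> k i}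
      = (choose) n ` ?D"
    unfolding D by force
  then show ?thesis
    using binomial_semigroup_eq_generated[OF n0 notin]
      embedding_dimension_generated_choose[OF n0 notin] card by simp
qed

end
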